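(* Let $\Gamma$ be a finitely generated abelian group, $E$ a finite list of elements of $\Gamma$, $r(A)=\operatorname{rank}\langle A\rangle$ for $A\subseteq E$, and $m:2^E\to\mathbb{R}$ any function; let $\mathcal{M}=(E,r,m)$. For $A\subseteq E$ let $\chi_{\mathcal{M}|A}(t)=\sum_{B\subseteq A}(-1)^{|B|}m(B)t^{r(\Gamma)-r(B)}$, where $r(\Gamma)=\operatorname{rank}\Gamma$. Then for $p_e\in[0,1]$, $$\mathbb{E}\bigl[\chi_{\mathcal{M}|E_{\underline p}}(t)\bigr]=t^{r(\Gamma)}\mathbf{Z}_{\mathcal{M}}\bigl(t,(-p_e)_{e\in E}\bigr),$$ and in particular, if $p_e=p\in(0,1]$ for all $e$, $$\mathbb{E}\bigl[\chi_{\mathcal{M}|E_p}(t)\bigr]=(-p)^{r(E)}t^{r(\Gamma)-r(E)}\,T_{\mathcal{M}}\Bigl(1-\frac tp,\ 1-p\Bigr).$$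
   Context: $\langle A\rangle$ is the subgroup generated by $A$. $\mathbf{Z}_{\mathcal{M}}(q,(v_e))=\sum_{A\subseteq E}m(A)q^{-r(A)}\prod_{e\in A}v_e$; $T_{\mathcal{M}}(x,y)=\sum_{A\subseteq E}m(A)(x-1)^{r(E)-r(A)}(y-1)^{|A|-r(A)}$. $E_{\underline p}$ is the random sublist containing each $e$ independently with probability $p_e$; $E_p$ the case all $p_e=p$. *)

theory Defs
  imports "HOL-Algebra.Algebra" "HOL-Probability.Probability"
begin

definition finitely_generated_group :: "('a, 'b) monoid_scheme \<Rightarrow> bool" where
  "finitely_generated_group G \<longleftrightarrow>
     group G \<and> (\<exists>S. finite S \<and> S \<subseteq> carrier G \<and> generate G S = carrier G)"

text \<open>Linear independence over the integers, written multiplicatively.\<close>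

definition int_independent :: "('a, 'b) monoid_scheme \<Rightarrow> 'a set \<Rightarrow> bool" where
  "int_independent G S \<longleftrightarrow>
     finite S \<and> S \<subseteq> carrier G \<and>
     (\<forall>c :: 'a \<Rightarrow> int.
        finprod G (\<lambda>x. x [^]\<^bsub>G\<^esub> c x) S = \<one>\<^bsub>G\<^esub> \<longrightarrow> (\<forall>x\<in>S. c x = 0))"

text \<open>
  The rank is the maximal size of an independent set.  The supremum is that of the natural
  numbers, so the definition is only meaningful when these sizes are bounded, as they are in
  every finitely generated abelian group and its subgroups.
\<close>

definition group_rank :: "('a, 'b) monoid_scheme \<Rightarrow> nat" where
  "group_rank G = Sup {card S | S. int_independent G S}"

text \<open>
  A sublist of a list is encoded by its set of positions, so that repeated elements of the list
  stay distinct.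
\<close>

definition sublist_rank :: "('a, 'b) monoid_scheme \<Rightarrow> 'a list \<Rightarrow> nat set \<Rightarrow> nat" where
  "sublist_rank G E A = group_rank (subgroup_generated G ((!) E ` A))"

definition multivariate_Tutte ::
  "'e set \<Rightarrow> ('e set \<Rightarrow> nat) \<Rightarrow> ('e set \<Rightarrow> real) \<Rightarrow> real \<Rightarrow> ('e \<Rightarrow> real) \<Rightarrow> real" where
  "multivariate_Tutte I r m q v =
     (\<Sum>A\<in>Pow I. m A * q powi (- int (r A)) * (\<Prod>e\<in>A. v e))"

text \<open>
  The exponents below are differences of natural numbers; no truncation occurs for the rank
  functions considered here, where \<open>r A \<le> r I\<close> and \<open>r A \<le> card A\<close> for \<open>A \<subseteq> I\<close>.
\<close>

definition Tutte ::
  "'e set \<Rightarrow> ('e set \<Rightarrow> nat) \<Rightarrow> ('e set \<Rightarrow> real) \<Rightarrow> real \<Rightarrow> real \<Rightarrow> real" where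
  "Tutte I r m x y =
     (\<Sum>A\<in>Pow I. m A * (x - 1) ^ (r I - r A) * (y - 1) ^ (card A - r A))"

text \<open>The parameter \<open>k\<close> is the rank of the ambient group, not that of \<open>A\<close>.\<close>

definition char_poly_restr ::
  "nat \<Rightarrow> ('e set \<Rightarrow> nat) \<Rightarrow> ('e set \<Rightarrow> real) \<Rightarrow> 'e set \<Rightarrow> real \<Rightarrow> real" where
  "char_poly_restr k r m A t = (\<Sum>B\<in>Pow A. (-1) ^ card B * m B * t ^ (k - r B))"

definition random_subset :: "'e set \<Rightarrow> ('e \<Rightarrow> real) \<Rightarrow> 'e set pmf" where
  "random_subset I p =
     map_pmf (\<lambda>b. {e \<in> I. b e}) (Pi_pmf I False (\<lambda>e. bernoulli_pmf (p e)))"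

end

theory Submission
  imports Defs
begin

text \<open>
  A fixed sublist \<open>B\<close> of \<open>E\<close> survives in the random sublist with probability
  \<open>\<Prod>e\<in>B. p e\<close>, so linearity of expectation gives
  \<open>\<Sum>B\<in>Pow E. (-1) ^ card B * m B * t ^ (r \<Gamma> - r B) * (\<Prod>e\<in>B. p e)\<close>.
  Both formulas are rearrangements of this sum, provided that no exponent is truncated, that is,
  \<open>r B \<le> r E \<le> r \<Gamma>\<close> and \<open>r B \<le> card B\<close>. These inequalities follow from the fact that an
  independent subset of a group generated by \<open>n\<close> elements has at most \<open>n\<close> elements: more than
  \<open>n\<close> integer vectors in \<open>n\<close> coordinates satisfy a nontrivial integer linear relation.
\<close>

section \<open>Independent sets in finitely generated abelian groups\<close>

text \<open>Elimination without division, by induction on the number of coordinates: a pivot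
  \<open>s\<^sub>0\<close> removes coordinate \<open>j\<close> from the remaining vectors. At most
  one vector is lost per coordinate, so the strict inequality persists.\<close>

lemma int_linear_relation_exists:
  fixes M :: "'s \<Rightarrow> 'j \<Rightarrow> int"
  assumes "finite J" and "finite S" and "card J < card S"
  shows "\<exists>c. (\<exists>s\<in>S. c s \<noteq> 0) \<and> (\<forall>j\<in>J. (\<Sum>s\<in>S. c s * M s j) = 0)"
  using assms
proof (induction J arbitrary: S M rule: finite_induct)
  case empty
  then have "S \<noteq> {}" by auto
  then show ?case by (intro exI[of _ "\<lambda>_. 1"]) auto
next
  case (insert j J)
  show ?case
  proof (cases "\<forall>s\<in>S. M s j = 0")
    case True
    have "card J < card S" using insert by simp
    with insert.IH[OF insert.prems(1)] True show ?thesis by fastforce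
  next
    case False
    then obtain s\<^sub>0 where s0: "s\<^sub>0 \<in> S" "M s\<^sub>0 j \<noteq> 0" by blast
    define S' where "S' = S - {s\<^sub>0}"
    have S': "finite S'" "s\<^sub>0 \<notin> S'" "S = insert s\<^sub>0 S'"
      using s0 insert.prems by (auto simp: S'_def)
    have "card J < card S'"
      using insert.prems insert.hyps S' by simp
    \<comment> \<open>Cross-multiplication with the pivot makes coordinate \<open>j\<close> vanish
      and keeps all entries integral.\<close>
    from insert.IH[OF S'(1) this, of "\<lambda>s i. M s\<^sub>0 j * M s i - M s j * M s\<^sub>0 i"]
    obtain c s\<^sub>1 where c: "s\<^sub>1 \<in> S'" "c s\<^sub>1 \<noteq> 0"
      "\<And>i. i \<in> J \<Longrightarrow> (\<Sum>s\<in>S'. c s * (M s\<^sub>0 j * M s i - M s j * M s\<^sub>0 i)) = 0"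
      by blast
    \<comment> \<open>The relation among the reduced vectors, expanded in the original ones:
      \<open>s\<^sub>0\<close> collects all multiples of the pivot vector.\<close>
    define d where "d s = (if s = s\<^sub>0 then - (\<Sum>s\<in>S'. c s * M s j) else M s\<^sub>0 j * c s)" for s
    have d: "(\<Sum>s\<in>S. d s * M s i) = (\<Sum>s\<in>S'. c s * (M s\<^sub>0 j * M s i - M s j * M s\<^sub>0 i))" for i
    proof -
      have "(\<Sum>s\<in>S'. d s * M s i) = (\<Sum>s\<in>S'. M s\<^sub>0 j * c s * M s i)"
        using S' by (intro sum.cong) (auto simp: d_def)
      then show ?thesis
        using S' by (simp add: d_def algebra_simps sum_subtractf sum_distrib_left sum_distrib_right)
    qed
    have "d s\<^sub>1 \<noteq> 0" "s\<^sub>1 \<in> S"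
      using c S' s0 by (auto simp: d_def)
    \<comment> \<open>For \<open>i = j\<close> every summand of the reduced sum is zero.\<close>
    moreover have "(\<Sum>s\<in>S. d s * M s i) = 0" if "i \<in> insert j J" for i
      using that c(3) by (auto simp: d algebra_simps)
    ultimately show ?thesis by blast
  qed
qed

lemma (in comm_group) finprod_delta_int_pow:
  assumes "finite U" and "U \<subseteq> carrier G" and "h \<in> U"
  shows "finprod G (\<lambda>x. x [^] (if x = h then i else 0 :: int)) U = h [^] i"
proof -
  have "finprod G (\<lambda>x. x [^] (if x = h then i else 0 :: int)) U
      = finprod G (\<lambda>x. if h = x then x [^] i else \<one>) U"
    using assms by (intro finprod_cong') auto
  also have "\<dots> = h [^] i"
    using assms by (intro finprod_singleton) auto
  finally show ?thesis .
qed

text \<open>By commutativity, multiplying two such products adds their exponents; generators and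
  their inverses have plus or minus a unit vector as exponents.\<close>

lemma (in comm_group) generate_eq_finprod:
  assumes "finite U" and "U \<subseteq> carrier G" and "g \<in> generate G U"
  shows "\<exists>c :: 'a \<Rightarrow> int. g = finprod G (\<lambda>x. x [^] c x) U"
  using assms(3)
proof (induction rule: generate.induct)
  case one
  then show ?case by (intro exI[of _ "\<lambda>_. 0"]) simp
next
  case (incl h)
  then show ?case
    using finprod_delta_int_pow[OF assms(1,2) incl, of 1] assms(2)
    by (intro exI[of _ "\<lambda>x. if x = h then 1 else 0"]) auto
next
  case (inv h)
  then show ?case
    using finprod_delta_int_pow[OF assms(1,2) inv, of "-1"] assms(2)
    by (intro exI[of _ "\<lambda>x. if x = h then -1 else 0"]) (auto simp: int_pow_neg)
next
  case (eng h1 h2)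
  then obtain c d :: "'a \<Rightarrow> int" where
    "h1 = finprod G (\<lambda>x. x [^] c x) U" "h2 = finprod G (\<lambda>x. x [^] d x) U"
    by blast
  moreover have "finprod G (\<lambda>x. x [^] (c x + d x)) U
      = finprod G (\<lambda>x. x [^] c x \<otimes> x [^] d x) U"
    using assms(2) by (intro finprod_cong') (auto simp: int_pow_mult)
  moreover have "\<dots> = finprod G (\<lambda>x. x [^] c x) U \<otimes> finprod G (\<lambda>x. x [^] d x) U"
    using assms(2) by (intro finprod_multf) auto
  ultimately show ?case by (intro exI[of _ "\<lambda>x. c x + d x"]) simp
qed

lemma (in comm_group) finprod_int_pow:
  assumes "f \<in> U \<rightarrow> carrier G"
  shows "finprod G f U [^] (n :: int) = finprod G (\<lambda>x. f x [^] n) U"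
  using assms
proof (induction U rule: infinite_finite_induct)
  case (insert x U)
  then show ?case by (simp add: Pi_iff int_pow_distrib)
qed simp_all

text \<open>Exponent vectors combine like rows of a matrix, so an integer relation among the rows
  \<open>M s\<close> becomes a multiplicative relation among the elements they represent.\<close>

lemma (in comm_group) finprod_int_pow_linear:
  fixes c :: "'s \<Rightarrow> int" and M :: "'s \<Rightarrow> 'a \<Rightarrow> int"
  assumes "finite S" and "U \<subseteq> carrier G"
  shows "finprod G (\<lambda>s. finprod G (\<lambda>x. x [^] M s x) U [^] c s) S
       = finprod G (\<lambda>x. x [^] (\<Sum>s\<in>S. c s * M s x)) U"
  using assms(1)
proof (induction S rule: finite_induct)
  case (insert s S)
  have closed: "(\<lambda>x. x [^] e x) \<in> U \<rightarrow> carrier G" for e :: "'a \<Rightarrow> int"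
    using assms(2) by auto
  have "finprod G (\<lambda>x. x [^] M s x) U [^] c s = finprod G (\<lambda>x. x [^] (c s * M s x)) U"
    using assms(2) closed
    by (subst finprod_int_pow) (auto simp: int_pow_pow mult.commute intro!: finprod_cong')
  moreover have "finprod G (\<lambda>x. x [^] (\<Sum>s\<in>insert s S. c s * M s x)) U
      = finprod G (\<lambda>x. x [^] (c s * M s x) \<otimes> x [^] (\<Sum>s\<in>S. c s * M s x)) U"
    using assms(2) insert.hyps closed
    by (intro finprod_cong') (auto simp: int_pow_mult)
  ultimately show ?case
    using insert closed by (simp add: finprod_closed[OF closed] finprod_multf[OF closed closed])
qed simp

text \<open>Exponent vectors over \<open>U\<close> need not be unique, which is harmless: a relation
  among any choice of them already gives a relation in the group.\<close>

lemma (in comm_group) int_independent_card_le: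
  assumes "finite U" and "U \<subseteq> carrier G"
    and "int_independent G S" and "S \<subseteq> generate G U"
  shows "card S \<le> card U"
proof (rule ccontr)
  assume "\<not> card S \<le> card U"
  have S: "finite S" "S \<subseteq> carrier G"
    using assms(3) by (auto simp: int_independent_def)
  have "\<forall>s\<in>S. \<exists>c :: 'a \<Rightarrow> int. s = finprod G (\<lambda>x. x [^] c x) U"
    using generate_eq_finprod[OF assms(1,2)] assms(4) by blast
  then obtain M :: "'a \<Rightarrow> 'a \<Rightarrow> int"
    where M: "\<And>s. s \<in> S \<Longrightarrow> s = finprod G (\<lambda>x. x [^] M s x) U"
    by metis
  obtain c where c: "\<exists>s\<in>S. c s \<noteq> 0" "\<And>x. x \<in> U \<Longrightarrow> (\<Sum>s\<in>S. c s * M s x) = 0"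
    using int_linear_relation_exists[OF assms(1) S(1), of M] \<open>\<not> card S \<le> card U\<close>
    by (metis not_le_imp_less)
  have "finprod G (\<lambda>s. s [^] c s) S
      = finprod G (\<lambda>s. finprod G (\<lambda>x. x [^] M s x) U [^] c s) S"
    using S by (intro finprod_cong') (auto simp flip: M)
  also have "\<dots> = finprod G (\<lambda>x. x [^] (\<Sum>s\<in>S. c s * M s x)) U"
    using S assms by (intro finprod_int_pow_linear)
  also have "\<dots> = \<one>"
    using c(2) by (intro finprod_one_eqI) simp
  finally show False
    using assms(3) c(1) by (auto simp: int_independent_def)
qed

lemma (in comm_group) finprod_subgroup_generated:
  assumes "f \<in> S \<rightarrow> carrier (subgroup_generated G Y)"
  shows "finprod (subgroup_generated G Y) f S = finprod G f S"
proof -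
  interpret H: comm_group "subgroup_generated G Y"
    by (rule abelian_subgroup_generated) (rule comm_group_axioms)
  show ?thesis
    using assms
  proof (induction S rule: infinite_finite_induct)
    case (insert s S)
    then have "f \<in> S \<rightarrow> carrier G" "f s \<in> carrier G"
      using carrier_subgroup_generated_subset[of Y] by auto
    with insert show ?case by (simp add: Pi_iff)
  qed simp_all
qed

text \<open>Powers and products of elements of a subgroup are the same in \<open>G\<close>, so the
  ranks of all subgroups become suprema over independent sets of the one group
  \<open>G\<close>.\<close>

lemma (in comm_group) int_independent_subgroup_generated:
  "int_independent (subgroup_generated G Y) S \<longleftrightarrow>
     int_independent G S \<and> S \<subseteq> carrier (subgroup_generated G Y)"
proof (cases "S \<subseteq> carrier (subgroup_generated G Y)")
  case True
  interpret H: comm_group "subgroup_generated G Y"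
    by (rule abelian_subgroup_generated) (rule comm_group_axioms)
  have "finprod (subgroup_generated G Y) (\<lambda>x. x [^]\<^bsub>subgroup_generated G Y\<^esub> c x) S
      = finprod G (\<lambda>x. x [^] c x) S" for c :: "'a \<Rightarrow> int"
  proof -
    have "finprod (subgroup_generated G Y) (\<lambda>x. x [^]\<^bsub>subgroup_generated G Y\<^esub> c x) S
        = finprod G (\<lambda>x. x [^]\<^bsub>subgroup_generated G Y\<^esub> c x) S"
      using True by (intro finprod_subgroup_generated) auto
    also have "\<dots> = finprod G (\<lambda>x. x [^] c x) S"
      using True carrier_subgroup_generated_subset[of Y]
      by (intro finprod_cong') (auto simp: int_pow_subgroup_generated)
    finally show ?thesis .
  qed
  with True show ?thesis
    using carrier_subgroup_generated_subset[of Y] by (auto simp: int_independent_def)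
qed (auto simp: int_independent_def)

section \<open>Inequalities between ranks\<close>

text \<open>Ensures that the suprema defining ranks range over nonempty sets.\<close>

lemma int_independent_empty: "int_independent G {}"
  by (simp add: int_independent_def)

lemma (in comm_group) group_rank_subgroup_generated_le_card:
  assumes "finite U" and "U \<subseteq> carrier G"
  shows "group_rank (subgroup_generated G U) \<le> card U"
  unfolding group_rank_def
proof (rule cSup_least)
  show "{card S |S. int_independent (subgroup_generated G U) S} \<noteq> {}"
    using int_independent_empty by blast
next
  fix n
  assume "n \<in> {card S |S. int_independent (subgroup_generated G U) S}"
  then show "n \<le> card U"
    using int_independent_card_le[OF assms] assms
    by (auto simp: int_independent_subgroup_generated carrier_subgroup_generated Int_absorb1)
qed

lemma bdd_above_int_independent_cards:
  assumes "comm_group G" and "finitely_generated_group G"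
  shows "bdd_above {card S |S. int_independent G S}"
proof -
  obtain U where "finite U" "U \<subseteq> carrier G" "generate G U = carrier G"
    using assms(2) by (auto simp: finitely_generated_group_def)
  then have "card S \<le> card U" if "int_independent G S" for S
    using comm_group.int_independent_card_le[OF assms(1), of U S] that
    by (simp add: int_independent_def)
  then show ?thesis by (auto intro!: bdd_aboveI[of _ "card U"])
qed

lemma group_rank_subgroup_generated_le:
  assumes "comm_group G" and "finitely_generated_group G"
  shows "group_rank (subgroup_generated G Y) \<le> group_rank G"
  unfolding group_rank_def
  using comm_group.int_independent_subgroup_generated[OF assms(1)] int_independent_empty
  by (intro cSup_subset_mono bdd_above_int_independent_cards assms) blast+

lemma group_rank_subgroup_generated_mono:
  assumes "comm_group G" and "finitely_generated_group G" and "Y \<subseteq> Z"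
  shows "group_rank (subgroup_generated G Y) \<le> group_rank (subgroup_generated G Z)"
  unfolding group_rank_def
proof (rule cSup_subset_mono)
  interpret comm_group G by fact
  show "{card S |S. int_independent (subgroup_generated G Y) S} \<noteq> {}"
    using int_independent_empty by blast
  show "bdd_above {card S |S. int_independent (subgroup_generated G Z) S}"
    \<comment> \<open>\<open>Z\<close> may be infinite, so the bound comes from the generators of
      the ambient group.\<close>
    by (rule bdd_above_mono[OF bdd_above_int_independent_cards[OF assms(1,2)]])
      (auto simp: int_independent_subgroup_generated)
  have "carrier (subgroup_generated G Y) \<subseteq> carrier (subgroup_generated G Z)"
    unfolding carrier_subgroup_generated using assms(3) by (intro mono_generate) auto
  then show "{card S |S. int_independent (subgroup_generated G Y) S}
      \<subseteq> {card S |S. int_independent (subgroup_generated G Z) S}"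
    by (auto simp: int_independent_subgroup_generated)
qed

text \<open>Repeated entries can make the image of \<open>A\<close> smaller than \<open>A\<close>,
  so the bound passes through the number of distinct generators.\<close>

lemma sublist_rank_le_card:
  assumes "comm_group G" and "set E \<subseteq> carrier G" and "A \<subseteq> {..<length E}"
  shows "sublist_rank G E A \<le> card A"
proof -
  have "finite A" using assms(3) finite_subset by blast
  moreover have "(!) E ` A \<subseteq> carrier G" using assms(2,3) by (force simp: subset_iff)
  ultimately have "sublist_rank G E A \<le> card ((!) E ` A)"
    unfolding sublist_rank_def
    by (intro comm_group.group_rank_subgroup_generated_le_card[OF assms(1)]) auto
  also have "\<dots> \<le> card A" using \<open>finite A\<close> by (rule card_image_le)
  finally show ?thesis .
qed

section \<open>Expectations over random subsets\<close>

text \<open>The event is a box: coordinates in \<open>B\<close> must be true and the others are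
  free, so independence factors its probability.\<close>

lemma prob_random_subset_superset:
  assumes "finite I" and "B \<subseteq> I" and "\<And>e. e \<in> I \<Longrightarrow> 0 \<le> p e \<and> p e \<le> 1"
  shows "measure_pmf.prob (random_subset I p) {A. B \<subseteq> A} = (\<Prod>e\<in>B. p e)"
proof -
  have "(\<lambda>b. {e \<in> I. b e}) -` {A. B \<subseteq> A} = Pi I (\<lambda>e. if e \<in> B then {True} else UNIV)"
    using assms(2) by (auto simp: Pi_iff split: if_splits)
  then have "measure_pmf.prob (random_subset I p) {A. B \<subseteq> A}
      = (\<Prod>e\<in>I. measure_pmf.prob (bernoulli_pmf (p e)) (if e \<in> B then {True} else UNIV))"
    using assms(1) by (simp add: random_subset_def measure_Pi_pmf_Pi)
  also have "\<dots> = (\<Prod>e\<in>I. if e \<in> B then p e else 1)"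
    using assms(3) by (intro prod.cong) (auto simp: measure_pmf_single)
  also have "\<dots> = (\<Prod>e\<in>B. p e)"
    using assms(1,2) by (simp add: prod.If_cases Int_absorb1)
  finally show ?thesis .
qed

lemma expectation_random_subset_sum_Pow:
  fixes g :: "'e set \<Rightarrow> real"
  assumes "finite I" and "\<And>e. e \<in> I \<Longrightarrow> 0 \<le> p e \<and> p e \<le> 1"
  shows "measure_pmf.expectation (random_subset I p) (\<lambda>A. \<Sum>B\<in>Pow A. g B)
       = (\<Sum>B\<in>Pow I. g B * (\<Prod>e\<in>B. p e))"
proof -
  have sub: "set_pmf (random_subset I p) \<subseteq> Pow I"
    by (auto simp: random_subset_def)
  have fin: "finite (set_pmf (random_subset I p))"
    using sub assms(1) finite_subset by blast
  \<comment> \<open>Indicators make the index set independent of the random set, so that expectation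
    and sum can be exchanged.\<close>
  have "(\<Sum>B\<in>Pow A. g B) = (\<Sum>B\<in>Pow I. g B * indicator {A. B \<subseteq> A} A)"
    if "A \<in> Pow I" for A
  proof -
    have "(\<Sum>B\<in>Pow A. g B) = (\<Sum>B\<in>Pow A. g B * indicator {A. B \<subseteq> A} A)"
      by (intro sum.cong) auto
    also have "\<dots> = (\<Sum>B\<in>Pow I. g B * indicator {A. B \<subseteq> A} A)"
      using that assms(1) by (intro sum.mono_neutral_left) auto
    finally show ?thesis .
  qed
  \<comment> \<open>The integrands need only agree on subsets of \<open>I\<close>, where the
    distribution is supported.\<close>
  then have "measure_pmf.expectation (random_subset I p) (\<lambda>A. \<Sum>B\<in>Pow A. g B)
      = measure_pmf.expectation (random_subset I p)
          (\<lambda>A. \<Sum>B\<in>Pow I. g B * indicator {A. B \<subseteq> A} A)"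
    using sub by (intro integral_cong_AE) (auto simp: AE_measure_pmf_iff)
  also have "\<dots> = (\<Sum>B\<in>Pow I. g B * measure_pmf.prob (random_subset I p) {A. B \<subseteq> A})"
    by (subst Bochner_Integration.integral_sum)
      (auto intro: integrable_measure_pmf_finite[OF fin])
  also have "\<dots> = (\<Sum>B\<in>Pow I. g B * (\<Prod>e\<in>B. p e))"
    using assms by (intro sum.cong) (auto simp: prob_random_subset_superset)
  finally show ?thesis .
qed

text \<open>The sign \<open>(-1) ^ card B\<close> is absorbed into the weights \<open>- p e\<close>.
  Keeping the natural exponent \<open>k - r B\<close> leaves \<open>t = 0\<close> available for the
  second formula.\<close>

lemma expectation_char_poly_restr:
  assumes "finite I" and "\<And>e. e \<in> I \<Longrightarrow> 0 \<le> p e \<and> p e \<le> 1"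
  shows "measure_pmf.expectation (random_subset I p) (\<lambda>A. char_poly_restr k r m A t)
       = (\<Sum>B\<in>Pow I. m B * t ^ (k - r B) * (\<Prod>e\<in>B. - p e))"
proof -
  have "(-1) ^ card B * m B * t ^ (k - r B) * (\<Prod>e\<in>B. p e)
      = m B * t ^ (k - r B) * (\<Prod>e\<in>B. - p e)" for B
    using prod_uminus[of p B] by simp
  then show ?thesis
    unfolding char_poly_restr_def
    by (simp only: expectation_random_subset_sum_Pow[OF assms])
qed

theorem theorem3p22:
  fixes G :: "('a, 'b) monoid_scheme" and E :: "'a list" and m :: "nat set \<Rightarrow> real"
  defines "I \<equiv> {..<length E}"
    and "r \<equiv> sublist_rank G E"
    and "k \<equiv> group_rank G"
  assumes "comm_group G" and "finitely_generated_group G" and "set E \<subseteq> carrier G"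
  shows "(\<forall>(p :: nat \<Rightarrow> real) (t :: real). (\<forall>e\<in>I. 0 \<le> p e \<and> p e \<le> 1) \<and> t \<noteq> 0 \<longrightarrow>
            measure_pmf.expectation (random_subset I p) (\<lambda>A. char_poly_restr k r m A t)
              = t ^ k * multivariate_Tutte I r m t (\<lambda>e. - p e))
       \<and> (\<forall>(p :: real) (t :: real). 0 < p \<and> p \<le> 1 \<longrightarrow>
            measure_pmf.expectation (random_subset I (\<lambda>_. p)) (\<lambda>A. char_poly_restr k r m A t)
              = (- p) ^ r I * t ^ (k - r I) * Tutte I r m (1 - t / p) (1 - p))"
proof (intro conjI allI impI)
  have fin: "finite I" by (simp add: I_def)
  \<comment> \<open>Positions outside \<open>I\<close> cause no trouble, since
    \<open>subgroup_generated\<close> only uses generators in the carrier.\<close>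
  have rk: "r A \<le> k" for A
    unfolding r_def k_def sublist_rank_def
    by (rule group_rank_subgroup_generated_le) fact+
  have rI: "r A \<le> r I" if "A \<subseteq> I" for A
    unfolding r_def sublist_rank_def
    using that by (intro group_rank_subgroup_generated_mono assms(4,5) image_mono)
  have rcard: "r A \<le> card A" if "A \<subseteq> I" for A
    unfolding r_def using that assms by (intro sublist_rank_le_card) auto
  show "measure_pmf.expectation (random_subset I p) (\<lambda>A. char_poly_restr k r m A t)
      = t ^ k * multivariate_Tutte I r m t (\<lambda>e. - p e)"
    if "(\<forall>e\<in>I. 0 \<le> p e \<and> p e \<le> 1) \<and> t \<noteq> 0" for p :: "nat \<Rightarrow> real" and t :: real
  proof -
    \<comment> \<open>The difference of natural numbers becomes an integer exponent by
      \<open>r A \<le> k\<close> and \<open>t \<noteq> 0\<close>.\<close>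
    have "t ^ (k - r A) = t ^ k * t powi (- int (r A))" for A
      using that rk[of A] by (simp add: power_diff power_int_minus divide_inverse)
    then show ?thesis
      using that fin
      by (simp add: expectation_char_poly_restr multivariate_Tutte_def sum_distrib_left mult_ac)
  qed
  show "measure_pmf.expectation (random_subset I (\<lambda>_. p)) (\<lambda>A. char_poly_restr k r m A t)
      = (- p) ^ r I * t ^ (k - r I) * Tutte I r m (1 - t / p) (1 - p)"
    if "0 < p \<and> p \<le> 1" for p t :: real
  proof -
    \<comment> \<open>For \<open>x = 1 - t / p\<close> and \<open>y = 1 - p\<close> the bases in the
      Tutte polynomial are \<open>x - 1 = - (t / p)\<close> and \<open>y - 1 = - p\<close>; terms
      are compared subset by subset.\<close>
    have "t ^ (k - r A) * (- p) ^ card A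
        = (- p) ^ r I * t ^ (k - r I) * ((- (t / p)) ^ (r I - r A) * (- p) ^ (card A - r A))"
      if A: "A \<subseteq> I" for A
    proof -
      \<comment> \<open>Each factor \<open>- p\<close> cancels one denominator, leaving pure powers
        of \<open>t\<close>; no division by \<open>t\<close> occurs.\<close>
      have "- (t / p) = t / (- p)" by simp
      then have "(- p) ^ (r I - r A) * (- (t / p)) ^ (r I - r A) = t ^ (r I - r A)"
        using \<open>0 < p \<and> p \<le> 1\<close> by (simp flip: power_mult_distrib)
      moreover have "t ^ (k - r A) = t ^ (k - r I) * t ^ (r I - r A)"
        using rk[of I] rI[OF A] by (simp flip: power_add)
      moreover have "(- p) ^ card A = (- p) ^ r A * (- p) ^ (card A - r A)"
        using rcard[OF A] by (simp flip: power_add)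
      moreover have "(- p) ^ r I = (- p) ^ r A * (- p) ^ (r I - r A)"
        using rI[OF A] by (simp flip: power_add)
      ultimately show ?thesis by (simp only: mult_ac)
    qed
    then have "m A * t ^ (k - r A) * (- p) ^ card A
        = (- p) ^ r I * t ^ (k - r I) * (m A * (- (t / p)) ^ (r I - r A) * (- p) ^ (card A - r A))"
      if "A \<in> Pow I" for A
      using that by (simp add: mult_ac)
    from sum.cong[OF refl[of "Pow I"] this, of "\<lambda>A. A"] show ?thesis
      using that fin by (simp add: expectation_char_poly_restr Tutte_def sum_distrib_left)
  qed
qed

end
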